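(* Let $\lambda$ be a monadic stream GSOS specification over a signature $\Sigma$ and output set $A$ such that $\Sigma$ contains, for each $a\in A$, a unary prefix operator $a.\_$ whose rules are $\frac{x\xrightarrow{b}x'}{a.x\xrightarrow{a}b.x'}$ for all $b\in A$, and assume that the set $T\emptyset$ of closed terms is non-empty. Let $\mathcal V$ be a set of variables. Then for all $t_1,t_2\in T\mathcal V$: $[\![t_1]\!]_o=[\![t_2]\!]_o$ if and only if $[\![\phi^\dagger(t_1)]\!]_c=[\![\phi^\dagger(t_2)]\!]_c$ for all $\phi:\mathcal V\to T\emptyset$.
   Context: A signature $\Sigma$ is a set of operation symbols with finite arities; $TX$ is the set of $\Sigma$-terms over $X$, $T\emptyset$ the closed terms. For $\phi:\mathcal V\to T\emptyset$, $\phi^\dagger:T\mathcal V\to T\emptyset$ substitutes $\phi(\mathcal X)$ for each variable $\mathcal X$. A monadic stream GSOS specification for $\Sigma$ and $A$ is a set of rules $\frac{x_1\xrightarrow{a_1}x_1'\cdots x_n\xrightarrow{a_n}x_n'}{f(x_1,\dots,x_n)\xrightarrow{a}t}$ ($f$ of arity $n$, pairwise distinct variables, $t$ a $\Sigma$-term over $\{x_1',\dots,x_n'\}$ only) such that for each $f$ and each $(a_1,\dots,a_n)\in A^n$ exactly one rule for $f$ has premise labels $(a_1,\dots,a_n)$. It induces a stream system on closed terms: $f(s_1,\dots,s_n)\xrightarrow{a}t[s_1'/x_1',\dots,s_n'/x_n']$ when $s_i\xrightarrow{a_i}s_i'$ and the rule for $f$ with premise labels $(a_1,\dots,a_n)$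 has conclusion $f(\vec x)\xrightarrow{a}t$. The closed semantics $[\![s]\!]_c\in A^\omega$ of $s\in T\emptyset$ is the stream $a_0a_1\cdots$ with $s=s_0\xrightarrow{a_0}s_1\xrightarrow{a_1}\cdots$. Open semantics: the Mealy machine $m_\lambda$ on $T\mathcal V$ has inputs $\varsigma:\mathcal V\to A$ and outputs in $A$; for a variable $\mathcal X$, $\mathcal X\xrightarrow{\varsigma\mid\varsigma(\mathcal X)}\mathcal X$, and $f(t_1,\dots,t_n)\xrightarrow{\varsigma\mid a}t[t_1'/x_1',\dots,t_n'/x_n']$ whenever $t_i\xrightarrow{\varsigma\mid a_i}t_i'$ for all $i$ and the rule for $f$ with premise labels $(a_1,\dots,a_n)$ has conclusion $f(\vec x)\xrightarrow{a}t$. For $t\in T\mathcal V$, $[\![t]\!]_o$ is the function $(A^\omega)^{\mathcal V}\to A^\omega$ with $[\![t]\!]_o(\psi)=a_0a_1a_2\cdots$ where $t_0=t$, $t_k\xrightarrow{\varsigma_k\mid a_k}t_{k+1}$ and $\varsigma_k(\mathcal X)=\psi(\mathcal X)(k)$. *)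

theory Defs
  imports Main "HOL-Library.Stream" "HOL-Library.FuncSet"
begin

text \<open>
  A signature is a type \<open>'f\<close> of operation symbols with an arity function
  \<open>ar :: 'f \<Rightarrow> nat\<close>; the output set is a type \<open>'a\<close>. The set of variables is
  a set rather than a type, so that it may be empty.
\<close>

datatype ('f, 'v) trm = Var 'v | Op 'f "('f, 'v) trm list"

inductive_set terms :: "('f \<Rightarrow> nat) \<Rightarrow> 'v set \<Rightarrow> ('f, 'v) trm set"
  for ar :: "'f \<Rightarrow> nat" and X :: "'v set" where
  Var: "x \<in> X \<Longrightarrow> Var x \<in> terms ar X"
| Op: "length ts = ar f \<Longrightarrow> \<forall>t \<in> set ts. t \<in> terms ar X \<Longrightarrow> Op f ts \<in> terms ar X"

primrec subst :: "('v \<Rightarrow> ('f, 'w) trm) \<Rightarrow> ('f, 'v) trm \<Rightarrow> ('f, 'w) trm" where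
  "subst \<phi> (Var x) = \<phi> x"
| "subst \<phi> (Op f ts) = Op f (map (subst \<phi>) ts)"

text \<open>
  \<open>Rule f [a\<^sub>1, \<dots>, a\<^sub>n] a t\<close> stands for the rule with premises
  \<open>x\<^sub>i \<rightarrow> x\<^sub>i'\<close> labelled \<open>a\<^sub>i\<close> and conclusion \<open>f(x\<^sub>1, \<dots>, x\<^sub>n) \<rightarrow> t\<close> labelled \<open>a\<close>.
  Rules are taken in a normal form for their bound variables: the variable
  \<open>x\<^sub>i'\<close> is the number \<open>i - 1\<close>. The \<open>x\<^sub>i\<close> cannot occur in \<open>t\<close> and need no name.
\<close>

datatype ('f, 'a) rule =
  Rule (oper: 'f) (labels: "'a list") (out: 'a) (target: "('f, nat) trm")

definition gsos_spec :: "('f \<Rightarrow> nat) \<Rightarrow> ('f, 'a) rule set \<Rightarrow> bool" where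
  "gsos_spec ar R \<longleftrightarrow>
     (\<forall>r \<in> R. length (labels r) = ar (oper r) \<and> target r \<in> terms ar {..<ar (oper r)}) \<and>
     (\<forall>f as. length as = ar f \<longrightarrow> (\<exists>!r. r \<in> R \<and> oper r = f \<and> labels r = as))"

definition prefix_operators ::
    "('f \<Rightarrow> nat) \<Rightarrow> ('f, 'a) rule set \<Rightarrow> ('a \<Rightarrow> 'f) \<Rightarrow> bool" where
  "prefix_operators ar R pre \<longleftrightarrow>
     (\<forall>a. ar (pre a) = 1 \<and> (\<forall>b. Rule (pre a) [b] a (Op (pre b) [Var 0]) \<in> R))"

inductive closed_step :: "('f, 'a) rule set \<Rightarrow> ('f, 'v) trm \<Rightarrow> 'a \<Rightarrow> ('f, 'v) trm \<Rightarrow> bool"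
  for R :: "('f, 'a) rule set" where
  "Rule f as a t \<in> R \<Longrightarrow> length ss = length as \<Longrightarrow> length ss' = length as \<Longrightarrow>
   \<forall>i < length as. closed_step R (ss ! i) (as ! i) (ss' ! i) \<Longrightarrow>
   closed_step R (Op f ss) a (subst (\<lambda>i. ss' ! i) t)"

inductive open_step ::
    "('f, 'a) rule set \<Rightarrow> ('v \<Rightarrow> 'a) \<Rightarrow> ('f, 'v) trm \<Rightarrow> 'a \<Rightarrow> ('f, 'v) trm \<Rightarrow> bool"
  for R :: "('f, 'a) rule set" and \<sigma> :: "'v \<Rightarrow> 'a" where
  "open_step R \<sigma> (Var x) (\<sigma> x) (Var x)"
| "Rule f as a t \<in> R \<Longrightarrow> length ts = length as \<Longrightarrow> length ts' = length as \<Longrightarrow>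
   \<forall>i < length as. open_step R \<sigma> (ts ! i) (as ! i) (ts' ! i) \<Longrightarrow>
   open_step R \<sigma> (Op f ts) a (subst (\<lambda>i. ts' ! i) t)"

text \<open>
  For a specification and a term of the appropriate kind, every state has
  exactly one step (per input), so the streams below exist and are unique.
\<close>

definition closed_sem :: "('f, 'a) rule set \<Rightarrow> ('f, 'v) trm \<Rightarrow> 'a stream" where
  "closed_sem R s =
     (THE as. \<exists>ss. ss 0 = s \<and> (\<forall>k. closed_step R (ss k) (as !! k) (ss (Suc k))))"

definition open_sem ::
    "('f, 'a) rule set \<Rightarrow> 'v set \<Rightarrow> ('f, 'v) trm \<Rightarrow> ('v \<Rightarrow> 'a stream) \<Rightarrow> 'a stream" where
  "open_sem R V t =
     (\<lambda>\<psi> \<in> V \<rightarrow>\<^sub>E UNIV. THE as. \<exists>ts. ts 0 = t \<and>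
        (\<forall>k. open_step R (\<lambda>x. \<psi> x !! k) (ts k) (as !! k) (ts (Suc k))))"

end

theory Submission imports Defs begin

text \<open>
  Substitution turns an open run into a closed one: if the inputs that \<open>t\<close> reads are the outputs of
  the closed terms \<open>\<phi> x\<close>, then running \<open>t\<close> and substituting the derivatives of the \<open>\<phi> x\<close> amounts to
  running \<open>\<phi>\<^sup>\<dagger>(t)\<close>. Hence the closed semantics of \<open>\<phi>\<^sup>\<dagger>(t)\<close> is the open semantics of \<open>t\<close> at
  \<open>x \<mapsto> \<lbrakk>\<phi> x\<rbrakk>\<^sub>c\<close>, which gives one direction. For the other one, the \<open>k\<close>-th output of an open term
  depends only on the first \<open>k + 1\<close> letters of the input streams, and the prefix operators, put in
  front of any closed term, produce a closed term whose semantics begins with those letters.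
\<close>

section \<open>Transitions as a recursive function, with the runs and outputs they generate\<close>

definition rule_of :: "('f, 'a) rule set \<Rightarrow> 'f \<Rightarrow> 'a list \<Rightarrow> ('f, 'a) rule" where
  "rule_of R f as = (THE r. r \<in> R \<and> oper r = f \<and> labels r = as)"

text \<open>A single total function serves both transition relations: a closed term never reaches
  the \<open>Var\<close> clause, so for it \<open>\<sigma>\<close> is a dummy.\<close>

primrec step :: "('f, 'a) rule set \<Rightarrow> ('v \<Rightarrow> 'a) \<Rightarrow> ('f, 'v) trm \<Rightarrow> 'a \<times> ('f, 'v) trm" where
  "step R \<sigma> (Var x) = (\<sigma> x, Var x)"
| "step R \<sigma> (Op f ts) =
     (let ps = map (step R \<sigma>) ts; r = rule_of R f (map fst ps)
      in (out r, subst (\<lambda>i. map snd ps ! i) (target r)))"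

primrec run ::
    "('f, 'a) rule set \<Rightarrow> (nat \<Rightarrow> 'v \<Rightarrow> 'a) \<Rightarrow> ('f, 'v) trm \<Rightarrow> nat \<Rightarrow> ('f, 'v) trm" where
  "run R \<zeta> t 0 = t"
| "run R \<zeta> t (Suc k) = snd (step R (\<zeta> k) (run R \<zeta> t k))"

definition output_at ::
    "('f, 'a) rule set \<Rightarrow> (nat \<Rightarrow> 'v \<Rightarrow> 'a) \<Rightarrow> ('f, 'v) trm \<Rightarrow> nat \<Rightarrow> 'a" where
  "output_at R \<zeta> t k = fst (step R (\<zeta> k) (run R \<zeta> t k))"

lemma subst_in_terms:
  assumes "t \<in> terms ar X" and "\<And>x. x \<in> X \<Longrightarrow> \<phi> x \<in> terms ar Y"
  shows "subst \<phi> t \<in> terms ar Y"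
  using assms(1)
proof induction
  case (Var x)
  then show ?case using assms(2) by simp
next
  case (Op ts f)
  then show ?case using terms.Op[of "map (subst \<phi>) ts" ar f Y] by simp
qed

lemma subst_cong:
  assumes "t \<in> terms ar X" and "\<And>x. x \<in> X \<Longrightarrow> \<phi> x = \<psi> x"
  shows "subst \<phi> t = subst \<psi> t"
  using assms(1) by induction (auto simp: assms(2))

lemma subst_subst: "subst \<phi> (subst \<psi> t) = subst (\<lambda>x. subst \<phi> (\<psi> x)) t"
  by (induction t) auto

lemma stream_eq_nth:
  assumes "\<And>k. s !! k = t !! k"
  shows "s = t"
proof -
  have "snth s = snth t" using assms by (rule ext)
  then show ?thesis using stream_smap_nats[of s] stream_smap_nats[of t] by argo
qed

lemma run_unique:
  assumes "ts 0 = t"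
    and "\<And>k. step R (\<zeta> k) (ts k) = (bs k, ts (Suc k))"
  shows "ts k = run R \<zeta> t k" and "bs k = output_at R \<zeta> t k"
proof -
  show *: "ts k = run R \<zeta> t k" for k
  proof (induction k)
    case (Suc k)
    from assms(2)[of k] Suc show ?case by simp
  qed (simp add: assms(1))
  from assms(2)[of k] show "bs k = output_at R \<zeta> t k"
    by (simp add: output_at_def flip: *)
qed

section \<open>Rules selected by a specification, and dependence of runs on the inputs\<close>

context
  fixes ar :: "'f \<Rightarrow> nat" and R :: "('f, 'a) rule set"
  assumes spec: "gsos_spec ar R"
begin

lemma rule_of:
  assumes "length as = ar f"
  shows "rule_of R f as \<in> R" "oper (rule_of R f as) = f" "labels (rule_of R f as) = as"
proof -
  from spec assms have "\<exists>!r. r \<in> R \<and> oper r = f \<and> labels r = as"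
    unfolding gsos_spec_def by blast
  from theI'[OF this] show "rule_of R f as \<in> R" "oper (rule_of R f as) = f"
    "labels (rule_of R f as) = as" unfolding rule_of_def by blast+
qed

lemma rule_of_eq:
  assumes "Rule f as a t \<in> R"
  shows "rule_of R f as = Rule f as a t"
proof -
  from spec assms have "length as = ar f"
    unfolding gsos_spec_def by fastforce
  with spec have "\<exists>!r. r \<in> R \<and> oper r = f \<and> labels r = as"
    unfolding gsos_spec_def by blast
  with assms show ?thesis
    unfolding rule_of_def by (intro the1_equality) auto
qed

lemma Rule_rule_of:
  assumes "length as = ar f"
  shows "Rule f as (out (rule_of R f as)) (target (rule_of R f as)) \<in> R"
  using rule_of[OF assms] by (metis rule.collapse)

lemma target_in_terms:
  assumes "length as = ar f"
  shows "target (rule_of R f as) \<in> terms ar {..<ar f}"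
  using rule_of[OF assms] spec unfolding gsos_spec_def by metis

lemma snd_step_in_terms:
  assumes "t \<in> terms ar X"
  shows "snd (step R \<sigma> t) \<in> terms ar X"
  using assms
  by induction (auto simp: Let_def intro!: terms.intros subst_in_terms[OF target_in_terms])

lemma run_in_terms:
  assumes "t \<in> terms ar X"
  shows "run R \<zeta> t k \<in> terms ar X"
  by (induction k) (simp_all add: assms snd_step_in_terms)

lemma step_cong:
  assumes "t \<in> terms ar X" and "\<And>x. x \<in> X \<Longrightarrow> \<sigma> x = \<tau> x"
  shows "step R \<sigma> t = step R \<tau> t"
  using assms(1)
proof induction
  case (Op ts f)
  then have "map (step R \<sigma>) ts = map (step R \<tau>) ts" by simp
  then show ?case by (simp only: step.simps)
qed (simp add: assms(2))

lemma run_cong: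
  assumes "t \<in> terms ar X" and "\<And>j x. j < k \<Longrightarrow> x \<in> X \<Longrightarrow> \<zeta> j x = \<eta> j x"
  shows "run R \<zeta> t k = run R \<eta> t k"
  using assms(2)
proof (induction k)
  case (Suc k)
  then show ?case
    using step_cong[OF run_in_terms[OF assms(1)], of "\<zeta> k" "\<eta> k"] by simp
qed simp

text \<open>Causality: the state at time \<open>k\<close> has consumed only the letters before
  \<open>k\<close>, and its output reads letter \<open>k\<close> as well. Hence
  \<open>j \<le> k\<close> here, against \<open>j < k\<close> in \<open>run_cong\<close>.\<close>

lemma output_at_cong:
  assumes "t \<in> terms ar X" and "\<And>j x. j \<le> k \<Longrightarrow> x \<in> X \<Longrightarrow> \<zeta> j x = \<eta> j x"
  shows "output_at R \<zeta> t k = output_at R \<eta> t k"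
  unfolding output_at_def
  using run_cong[OF assms(1), of k \<zeta> \<eta>]
    step_cong[OF run_in_terms[OF assms(1)], of "\<zeta> k" "\<eta> k"] assms(2) by simp

section \<open>Agreement of the recursive function with the transition relations and the two
  semantics\<close>

lemma open_step_step:
  assumes "t \<in> terms ar X"
  shows "open_step R \<sigma> t (fst (step R \<sigma> t)) (snd (step R \<sigma> t))"
  using assms
proof induction
  case (Op ts f)
  let ?as = "map fst (map (step R \<sigma>) ts)"
  have "open_step R \<sigma> (Op f ts) (out (rule_of R f ?as))
          (subst (\<lambda>i. map snd (map (step R \<sigma>) ts) ! i) (target (rule_of R f ?as)))"
    using Op by (intro open_step.intros(2)[OF Rule_rule_of]) auto
  then show ?case by (simp add: Let_def)
qed (simp add: open_step.intros)

lemma closed_step_step: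
  assumes "t \<in> terms ar {}"
  shows "closed_step R t (fst (step R \<sigma> t)) (snd (step R \<sigma> t))"
  using assms
proof induction
  case (Op ts f)
  let ?as = "map fst (map (step R \<sigma>) ts)"
  have "closed_step R (Op f ts) (out (rule_of R f ?as))
          (subst (\<lambda>i. map snd (map (step R \<sigma>) ts) ! i) (target (rule_of R f ?as)))"
    using Op by (intro closed_step.intros[OF Rule_rule_of]) auto
  then show ?case by (simp add: Let_def)
qed simp

lemma step_if_open_step:
  assumes "open_step R \<sigma> t a t'"
  shows "step R \<sigma> t = (a, t')"
  using assms
proof induction
  case (2 f as a t ts ts')
  then have "map (step R \<sigma>) ts = zip as ts'"
    by (intro nth_equalityI) auto
  with 2 rule_of_eq[OF 2(1)] show ?case by (simp add: Let_def flip: map_map)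
qed simp

text \<open>The only clause of \<open>closed_step\<close> is also a clause of
  \<open>open_step\<close>, so closed steps inherit determinism from
  \<open>step_if_open_step\<close>, for whatever \<open>\<sigma>\<close>.\<close>

lemma open_step_if_closed_step:
  assumes "closed_step R t a t'"
  shows "open_step R \<sigma> t a t'"
  using assms
proof induction
  case (1 f as a t ss ss')
  then show ?case by (intro open_step.intros(2)) auto
qed

text \<open>For the stream described by \<open>THE\<close>, \<open>run\<close> is the witness of
  existence and \<open>run_unique\<close> gives uniqueness.\<close>

lemma open_sem_nth:
  assumes "t \<in> terms ar V" and "\<psi> \<in> V \<rightarrow>\<^sub>E UNIV"
  shows "open_sem R V t \<psi> !! k = output_at R (\<lambda>k x. \<psi> x !! k) t k"
proof -
  define \<zeta> where "\<zeta> = (\<lambda>k x. \<psi> x !! k)"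
  have "(THE as. \<exists>ts. ts 0 = t \<and> (\<forall>k. open_step R (\<zeta> k) (ts k) (as !! k) (ts (Suc k)))) =
    smap (output_at R \<zeta> t) nats"
  proof (rule the_equality)
    show "\<exists>ts. ts 0 = t \<and>
        (\<forall>k. open_step R (\<zeta> k) (ts k) (smap (output_at R \<zeta> t) nats !! k) (ts (Suc k)))"
      using open_step_step[OF run_in_terms[OF assms(1)]]
      by (intro exI[of _ "run R \<zeta> t"]) (simp add: output_at_def)
  next
    fix as
    assume "\<exists>ts. ts 0 = t \<and> (\<forall>k. open_step R (\<zeta> k) (ts k) (as !! k) (ts (Suc k)))"
    then obtain ts where "ts 0 = t" "\<And>k. open_step R (\<zeta> k) (ts k) (as !! k) (ts (Suc k))"
      by blast
    then have "as !! k = output_at R \<zeta> t k" for k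
      by (intro run_unique(2)[of ts]) (auto dest: step_if_open_step)
    then show "as = smap (output_at R \<zeta> t) nats"
      by (intro stream_eq_nth) simp
  qed
  with assms(2) show ?thesis
    by (simp add: open_sem_def \<zeta>_def)
qed

text \<open>As for open terms, except that \<open>\<zeta>\<close> is arbitrary: a closed term reads
  no input.\<close>

lemma closed_sem_nth:
  assumes "t \<in> terms ar {}"
  shows "closed_sem R t !! k = output_at R \<zeta> t k"
proof -
  have "closed_sem R t = smap (output_at R \<zeta> t) nats"
    unfolding closed_sem_def
  proof (rule the_equality)
    show "\<exists>ts. ts 0 = t \<and>
        (\<forall>k. closed_step R (ts k) (smap (output_at R \<zeta> t) nats !! k) (ts (Suc k)))"
      using closed_step_step[OF run_in_terms[OF assms]]
      by (intro exI[of _ "run R \<zeta> t"]) (simp add: output_at_def)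
  next
    fix as
    assume "\<exists>ts. ts 0 = t \<and> (\<forall>k. closed_step R (ts k) (as !! k) (ts (Suc k)))"
    then obtain ts where "ts 0 = t" "\<And>k. closed_step R (ts k) (as !! k) (ts (Suc k))"
      by blast
    then have "as !! k = output_at R \<zeta> t k" for k
      by (intro run_unique(2)[of ts])
        (auto intro: step_if_open_step open_step_if_closed_step)
    then show "as = smap (output_at R \<zeta> t) nats"
      by (intro stream_eq_nth) simp
  qed
  then show ?thesis by simp
qed

section \<open>Compatibility of transitions, runs and semantics with substitution\<close>

lemma step_subst:
  fixes \<phi> :: "'v \<Rightarrow> ('f, 'w) trm" and \<sigma> :: "'w \<Rightarrow> 'a"
  assumes "t \<in> terms ar X"
  defines "\<tau> \<equiv> \<lambda>x. fst (step R \<sigma> (\<phi> x))"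
  shows "step R \<sigma> (subst \<phi> t) =
    (fst (step R \<tau> t), subst (\<lambda>x. snd (step R \<sigma> (\<phi> x))) (snd (step R \<tau> t)))"
  using assms(1)
proof induction
  \<comment> \<open>By induction each argument emits the same letter before and after substitution,
    so the same rule fires on both sides and only the derivatives remain to be compared.\<close>
  case (Op ts f)
  define \<phi>' where "\<phi>' = (\<lambda>x. snd (step R \<sigma> (\<phi> x)))"
  let ?as = "map (\<lambda>u. fst (step R \<tau> u)) ts"
  have fsts: "map (\<lambda>u. fst (step R \<sigma> (subst \<phi> u))) ts = ?as"
    and snds: "map (\<lambda>u. snd (step R \<sigma> (subst \<phi> u))) ts =
      map (\<lambda>u. subst \<phi>' (snd (step R \<tau> u))) ts"
    using Op by (simp_all add: \<phi>'_def)
  \<comment> \<open>Pulling \<open>subst \<phi>'\<close> out of the list lookup is justified for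
    indices below \<open>length ts\<close>; the target contains no other variables.\<close>
  have "subst (\<lambda>i. map (\<lambda>u. subst \<phi>' (snd (step R \<tau> u))) ts ! i) (target (rule_of R f ?as)) =
    subst (\<lambda>i. subst \<phi>' (map (\<lambda>u. snd (step R \<tau> u)) ts ! i)) (target (rule_of R f ?as))"
    using Op by (intro subst_cong[OF target_in_terms]) auto
  then show ?case
    by (simp add: Let_def o_def fsts snds subst_subst flip: \<phi>'_def)
qed (simp add: \<tau>_def)

text \<open>This iterates \<open>step_subst\<close>: variables step to themselves in an open run, so
  the terms plugged in for them evolve in lockstep with the open term.\<close>

lemma run_subst:
  assumes "t \<in> terms ar X"
  shows "run R \<zeta> (subst \<phi> t) k =
    subst (\<lambda>x. run R \<zeta> (\<phi> x) k) (run R (\<lambda>k x. output_at R \<zeta> (\<phi> x) k) t k)"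
  by (induction k) (simp_all add: step_subst[OF run_in_terms[OF assms]] output_at_def)

lemma output_at_subst:
  assumes "t \<in> terms ar X"
  shows "output_at R \<zeta> (subst \<phi> t) k = output_at R (\<lambda>k x. output_at R \<zeta> (\<phi> x) k) t k"
  unfolding output_at_def[of _ _ "subst \<phi> t"] run_subst[OF assms]
    step_subst[OF run_in_terms[OF assms]]
  by (simp add: output_at_def)

lemma closed_sem_subst:
  fixes \<phi> :: "'v \<Rightarrow> ('f, 'w) trm"
  assumes "t \<in> terms ar V" and "\<And>x. x \<in> V \<Longrightarrow> \<phi> x \<in> terms ar {}"
  shows "closed_sem R (subst \<phi> t) = open_sem R V t (\<lambda>x \<in> V. closed_sem R (\<phi> x))"
proof (rule stream_eq_nth)
  fix k
  \<comment> \<open>A placeholder valuation, which closed terms never consult.\<close>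
  define \<zeta> :: "nat \<Rightarrow> 'w \<Rightarrow> 'a" where "\<zeta> = undefined"
  let ?\<psi> = "\<lambda>x \<in> V. closed_sem R (\<phi> x)"
  have "closed_sem R (subst \<phi> t) !! k = output_at R \<zeta> (subst \<phi> t) k"
    by (rule closed_sem_nth) (rule subst_in_terms[OF assms])
  also have "\<dots> = output_at R (\<lambda>k x. output_at R \<zeta> (\<phi> x) k) t k"
    by (rule output_at_subst[OF assms(1)])
  also have "\<dots> = output_at R (\<lambda>k x. ?\<psi> x !! k) t k"
  \<comment> \<open>Outside \<open>V\<close> the term \<open>\<phi> x\<close> need not be closed and
    \<open>?\<psi> x\<close> is \<open>undefined\<close>; only variables in \<open>V\<close> have to
    be compared.\<close>
  proof (rule output_at_cong[OF assms(1)])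
    fix j x
    assume "x \<in> V"
    with closed_sem_nth[OF assms(2)[OF this]] show "output_at R \<zeta> (\<phi> x) j = ?\<psi> x !! j"
      by simp
  qed
  also have "\<dots> = open_sem R V t ?\<psi> !! k"
    by (rule open_sem_nth[OF assms(1), symmetric]) auto
  finally show "closed_sem R (subst \<phi> t) !! k = open_sem R V t ?\<psi> !! k" .
qed

lemma open_sem_cong:
  assumes "t \<in> terms ar V" "\<psi> \<in> V \<rightarrow>\<^sub>E UNIV" "\<psi>' \<in> V \<rightarrow>\<^sub>E UNIV"
    and "\<And>j x. j \<le> k \<Longrightarrow> x \<in> V \<Longrightarrow> \<psi> x !! j = \<psi>' x !! j"
  shows "open_sem R V t \<psi> !! k = open_sem R V t \<psi>' !! k"
  unfolding open_sem_nth[OF assms(1,2)] open_sem_nth[OF assms(1,3)]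
  by (rule output_at_cong[OF assms(1)]) (rule assms(4))

section \<open>Prefix operators and closed terms with prescribed initial outputs\<close>

context
  fixes pre :: "'a \<Rightarrow> 'f"
  assumes pre: "prefix_operators ar R pre"
begin

lemma prefix_in_terms: "t \<in> terms ar X \<Longrightarrow> Op (pre a) [t] \<in> terms ar X"
  using pre by (auto simp: prefix_operators_def intro: terms.intros)

text \<open>A prefix operator is a one-letter delay: it emits the stored letter and stores the one
  that \<open>t\<close> emits in the same step.\<close>

lemma step_prefix:
  "step R \<sigma> (Op (pre a) [t]) = (a, Op (pre (fst (step R \<sigma> t))) [snd (step R \<sigma> t)])"
proof -
  have "rule_of R (pre a) [b] = Rule (pre a) [b] a (Op (pre b) [Var 0])" for b
    using pre by (intro rule_of_eq) (auto simp: prefix_operators_def)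
  then show ?thesis by simp
qed

text \<open>The formula starts at \<open>Suc k\<close> because before the first step the stored
  letter is \<open>a\<close>, not an output of \<open>t\<close>.\<close>

lemma run_prefix_Suc:
  "run R \<zeta> (Op (pre a) [t]) (Suc k) = Op (pre (output_at R \<zeta> t k)) [run R \<zeta> t (Suc k)]"
  by (induction k) (simp_all add: step_prefix output_at_def del: step.simps)

lemma output_at_prefix:
  "output_at R \<zeta> (Op (pre a) [t]) k = (case k of 0 \<Rightarrow> a | Suc j \<Rightarrow> output_at R \<zeta> t j)"
proof (cases k)
  case 0
  then show ?thesis by (simp add: output_at_def step_prefix del: step.simps)
next
  case (Suc j)
  then show ?thesis
    by (simp add: output_at_def[of _ _ "Op (pre a) [t]"] run_prefix_Suc step_prefix
        del: step.simps run.simps(2))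
qed

lemma foldr_prefix_in_terms:
  assumes "t \<in> terms ar X"
  shows "foldr (\<lambda>a u. Op (pre a) [u]) as t \<in> terms ar X"
  using assms by (induction as) (auto intro: prefix_in_terms)

lemma output_at_foldr_prefix:
  assumes "k < length as"
  shows "output_at R \<zeta> (foldr (\<lambda>a u. Op (pre a) [u]) as t) k = as ! k"
  using assms by (induction as arbitrary: k) (auto simp: output_at_prefix split: nat.split)

lemma closed_terms_approximate:
  assumes "terms ar ({} :: 'v set) \<noteq> {}"
  obtains t :: "('f, 'v) trm" where "t \<in> terms ar {}" "\<And>j. j \<le> k \<Longrightarrow> closed_sem R t !! j = s !! j"
proof -
  obtain u :: "('f, 'v) trm" where u: "u \<in> terms ar {}" using assms by blast
  \<comment> \<open>Positions \<open>0\<close> to \<open>k\<close> require \<open>Suc k\<close>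
    letters; the closed term \<open>u\<close> beneath them affects later positions only.\<close>
  let ?t = "foldr (\<lambda>a u. Op (pre a) [u]) (stake (Suc k) s) u"
  have "?t \<in> terms ar {}" by (intro foldr_prefix_in_terms u)
  moreover from this have "closed_sem R ?t !! j = s !! j" if "j \<le> k" for j
    using that by (subst closed_sem_nth) (auto simp: output_at_foldr_prefix stake_nth simp del: stake.simps)
  ultimately show ?thesis by (rule that)
qed

end

end

section \<open>Equality of open semantics against equality of all closed instances\<close>

theorem theorem4:
  fixes ar :: "'f \<Rightarrow> nat" and R :: "('f, 'a) rule set" and pre :: "'a \<Rightarrow> 'f"
    and V :: "'v set" and t1 t2 :: "('f, 'v) trm"
  assumes "gsos_spec ar R"
    and "prefix_operators ar R pre"
    and "terms ar ({} :: 'v set) \<noteq> {}"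
    and "t1 \<in> terms ar V" and "t2 \<in> terms ar V"
  shows "open_sem R V t1 = open_sem R V t2 \<longleftrightarrow>
    (\<forall>\<phi> \<in> V \<rightarrow>\<^sub>E terms ar ({} :: 'v set).
       closed_sem R (subst \<phi> t1) = closed_sem R (subst \<phi> t2))"
proof
  assume "open_sem R V t1 = open_sem R V t2"
  moreover have "closed_sem R (subst \<phi> t) = open_sem R V t (\<lambda>x \<in> V. closed_sem R (\<phi> x))"
    if "t \<in> terms ar V" "\<phi> \<in> V \<rightarrow>\<^sub>E terms ar {}" for t and \<phi> :: "'v \<Rightarrow> ('f, 'v) trm"
    using closed_sem_subst[OF assms(1) that(1)] PiE_mem[OF that(2)] by blast
  ultimately show "\<forall>\<phi> \<in> V \<rightarrow>\<^sub>E terms ar ({} :: 'v set).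
      closed_sem R (subst \<phi> t1) = closed_sem R (subst \<phi> t2)"
    using assms(4,5) by simp
next
  assume closed: "\<forall>\<phi> \<in> V \<rightarrow>\<^sub>E terms ar ({} :: 'v set).
    closed_sem R (subst \<phi> t1) = closed_sem R (subst \<phi> t2)"
  \<comment> \<open>The position \<open>k\<close> is fixed before the closed terms are chosen: an
    arbitrary stream need not be the semantics of a closed term, but by causality agreement up to
    \<open>k\<close> suffices.\<close>
  have "open_sem R V t1 \<psi> !! k = open_sem R V t2 \<psi> !! k" if \<psi>: "\<psi> \<in> V \<rightarrow>\<^sub>E UNIV" for \<psi> k
  proof -
    have "\<exists>t :: ('f, 'v) trm. t \<in> terms ar {} \<and> (\<forall>j \<le> k. closed_sem R t !! j = \<psi> x !! j)" for x
      using closed_terms_approximate[OF assms(1-3), of k "\<psi> x"] by metis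
    then obtain c :: "'v \<Rightarrow> ('f, 'v) trm" where c: "\<And>x. c x \<in> terms ar {}"
      "\<And>x j. j \<le> k \<Longrightarrow> closed_sem R (c x) !! j = \<psi> x !! j"
      by metis
    \<comment> \<open>Restriction to \<open>V\<close> makes the substitution extensional, as the
      quantifier over \<open>\<phi>\<close> demands.\<close>
    define \<phi> where "\<phi> = restrict c V"
    have \<phi>: "\<phi> \<in> V \<rightarrow>\<^sub>E terms ar {}" by (simp add: \<phi>_def c)
    have "open_sem R V t \<psi> !! k = closed_sem R (subst \<phi> t) !! k" if t: "t \<in> terms ar V" for t
    proof -
      have "open_sem R V t \<psi> !! k = open_sem R V t (\<lambda>x \<in> V. closed_sem R (\<phi> x)) !! k"
        using \<psi> c(2) by (intro open_sem_cong[OF assms(1) t]) (auto simp: \<phi>_def)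
      then show ?thesis
        using closed_sem_subst[OF assms(1) t, of \<phi>] PiE_mem[OF \<phi>] by simp
    qed
    with assms(4,5) closed \<phi> show ?thesis by simp
  qed
  \<comment> \<open>Off the extensional functions both sides are \<open>undefined\<close>, so
    equality holds on the whole function type.\<close>
  moreover have "open_sem R V t1 \<psi> = open_sem R V t2 \<psi>" if "\<psi> \<notin> V \<rightarrow>\<^sub>E UNIV" for \<psi>
    using that by (simp add: open_sem_def)
  ultimately show "open_sem R V t1 = open_sem R V t2"
    by (intro ext stream_eq_nth) metis
qed

end
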